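(* The squarefree ternary word $\mathbf{vtm}$ avoids Caesar squares of length $12$ or greater. That is, no factor of $\mathbf{vtm}$ of length at least $12$ is a Caesar square over the alphabet $\{0,1,2\}$.
   Context: The word $\mathbf{vtm} \in \{0,1,2\}^{\omega}$ is the infinite fixed point of the morphism $0 \mapsto 012$, $1 \mapsto 02$, $2 \mapsto 1$ (it begins with $0$). A factor of an infinite word is a finite contiguous subsequence. Let $\mathbb{Z}/3\mathbb{Z}$ act on the alphabet $\{0,1,2\}$ with its generator sending $i$ to $i+1 \pmod 3$, and act letterwise on words. A Caesar square over $\{0,1,2\}$ is a word of the form $xx'$ with $|x| = |x'| > 0$ such that $x' = g\cdot x$ for some $g \in \mathbb{Z}/3\mathbb{Z}$ (the identity is allowed). The length of the Caesar square is $|xx'| = 2|x|$. *)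

theory Defs
  imports "HOL-Library.Stream" "HOL-Library.Numeral_Type"
begin

text \<open>
  The alphabet \<open>{0,1,2}\<close> is the type \<open>3\<close> of \<open>HOL-Library.Numeral_Type\<close>; its elements are
  \<open>0, 1, 2\<close> and its arithmetic is modulo 3, so it also serves as the group \<open>Z/3Z\<close>.
\<close>

lemma three_cases:
  fixes a :: 3
  obtains "a = 0" | "a = 1" | "a = 2"
proof (cases a rule: bit1_cases)
  case (of_int z)
  then have "z = 0 \<or> z = 1 \<or> z = 2" by auto
  then show thesis using of_int that by auto
qed

lemma three_distinct:
  "(0::3) \<noteq> 1" "(0::3) \<noteq> 2" "(1::3) \<noteq> 2" "(2::3) + 1 = 0"
  by simp_all

definition vtm_morphism :: "3 \<Rightarrow> 3 list" where
  "vtm_morphism a = (if a = 0 then [0, 1, 2] else if a = 1 then [0, 2] else [1])"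

text \<open>
  A morphism with nonempty images acts on infinite words by \<open>w \<mapsto> flat (smap f w)\<close>.
  Existence and uniqueness of the described stream are proved in \<open>vtm_ex1\<close>.
\<close>

definition vtm :: "3 stream" where
  "vtm = (THE w. shd w = 0 \<and> flat (smap vtm_morphism w) = w)"

definition factor :: "'a list \<Rightarrow> 'a stream \<Rightarrow> bool" where
  "factor u w \<longleftrightarrow> (\<exists>p s. w = p @- u @- s)"

definition caesar_shift :: "3 \<Rightarrow> 3 list \<Rightarrow> 3 list" where
  "caesar_shift g x = map (\<lambda>a. a + g) x"

definition caesar_square :: "3 list \<Rightarrow> bool" where
  "caesar_square u \<longleftrightarrow>
     (\<exists>x x'. u = x @ x' \<and> length x = length x' \<and> length x > 0 \<and> (\<exists>g. x' = caesar_shift g x))"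

lemma vtm_morphism_nonempty: "vtm_morphism a \<noteq> []"
  by (simp add: vtm_morphism_def)

lemma flat_smap_vtm_morphism_shift:
  "flat (smap vtm_morphism (u @- s)) = concat (map vtm_morphism u) @- flat (smap vtm_morphism s)"
proof (induction u)
  case Nil
  show ?case by simp
next
  case (Cons a u)
  then show ?case by (simp add: flat_Stream vtm_morphism_nonempty)
qed

definition vtm_approx :: "nat \<Rightarrow> 3 list" where
  "vtm_approx n = ((\<lambda>u. concat (map vtm_morphism u)) ^^ n) [0]"

lemma vtm_approx_0: "vtm_approx 0 = [0]"
  and vtm_approx_Suc: "vtm_approx (Suc n) = concat (map vtm_morphism (vtm_approx n))"
  by (simp_all add: vtm_approx_def)

lemma length_concat_vtm_morphism: "length u \<le> length (concat (map vtm_morphism u))"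
proof (induction u)
  case (Cons a u)
  moreover have "1 \<le> length (vtm_morphism a)" by (simp add: vtm_morphism_def)
  ultimately show ?case by simp
qed simp

lemma vtm_approx_step: "\<exists>t. t \<noteq> [] \<and> vtm_approx (Suc n) = vtm_approx n @ t"
proof (induction n)
  case 0
  show ?case by (simp add: vtm_approx_Suc vtm_approx_0 vtm_morphism_def)
next
  case (Suc n)
  then obtain t where t: "t \<noteq> []" "vtm_approx (Suc n) = vtm_approx n @ t" by blast
  have "vtm_approx (Suc (Suc n)) = concat (map vtm_morphism (vtm_approx n @ t))"
    unfolding t(2)[symmetric] by (rule vtm_approx_Suc)
  then have "vtm_approx (Suc (Suc n)) = vtm_approx (Suc n) @ concat (map vtm_morphism t)"
    by (simp add: vtm_approx_Suc)
  moreover have "concat (map vtm_morphism t) \<noteq> []"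
    using t(1) length_concat_vtm_morphism[of t] by fastforce
  ultimately show ?case by blast
qed

lemma vtm_approx_length: "n < length (vtm_approx n)"
proof (induction n)
  case 0
  show ?case by (simp add: vtm_approx_0)
next
  case (Suc n)
  obtain t where "t \<noteq> []" "vtm_approx (Suc n) = vtm_approx n @ t"
    using vtm_approx_step by blast
  with Suc show ?case by (cases t) auto
qed

lemma vtm_approx_prefix: "m \<le> n \<Longrightarrow> \<exists>t. vtm_approx n = vtm_approx m @ t"
proof (induction n rule: dec_induct)
  case (step n)
  then show ?case using vtm_approx_step[of n] by force
qed simp

lemma fixed_point_vtm_approx:
  assumes "shd w = 0" "flat (smap vtm_morphism w) = w"
  shows "\<exists>s. w = vtm_approx n @- s"
proof (induction n)
  case 0
  show ?case using assms(1) by (intro exI[of _ "stl w"]) (simp add: vtm_approx_0 stream.expand)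
next
  case (Suc n)
  then show ?case
    using assms(2) flat_smap_vtm_morphism_shift by (metis vtm_approx_Suc)
qed

lemma vtm_approx_snth_eqI:
  assumes "\<And>n. \<exists>s. w = vtm_approx n @- s" "\<And>n. \<exists>s. w' = vtm_approx n @- s"
  shows "w = w'"
proof -
  have "w !! n = w' !! n" for n
  proof -
    obtain s s' where "w = vtm_approx n @- s" "w' = vtm_approx n @- s'"
      using assms by blast
    then show ?thesis using vtm_approx_length[of n] by simp
  qed
  then show ?thesis by (metis smap_alt stream.map_id)
qed

lemma vtm_ex1: "\<exists>!w. shd w = 0 \<and> flat (smap vtm_morphism w) = w"
proof (rule ex_ex1I)
  define w where "w = smap (\<lambda>n. vtm_approx n ! n) nats"
  have nth: "w !! k = vtm_approx n ! k" if "k < length (vtm_approx n)" for k n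
  proof -
    have "vtm_approx k ! k = vtm_approx n ! k"
      using vtm_approx_prefix[of k n] vtm_approx_prefix[of n k] vtm_approx_length[of k] that
        nat_le_linear[of k n] by (auto simp: nth_append)
    then show ?thesis by (simp add: w_def)
  qed
  have pre: "\<exists>s. w = vtm_approx n @- s" for n
  proof -
    have "stake (length (vtm_approx n)) w = vtm_approx n"
      by (rule nth_equalityI) (simp_all add: nth)
    then show ?thesis by (metis stake_sdrop)
  qed
  have "\<exists>s. flat (smap vtm_morphism w) = vtm_approx n @- s" for n
  proof -
    obtain s where "w = vtm_approx n @- s" using pre by blast
    then have "flat (smap vtm_morphism w) = vtm_approx (Suc n) @- flat (smap vtm_morphism s)"
      using flat_smap_vtm_morphism_shift vtm_approx_Suc by simp
    then show ?thesis using vtm_approx_step[of n] by force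
  qed
  then have "flat (smap vtm_morphism w) = w" using pre by (intro vtm_approx_snth_eqI)
  moreover have "shd w = 0" using pre[of 0] by (auto simp: vtm_approx_0)
  ultimately show "\<exists>w. shd w = 0 \<and> flat (smap vtm_morphism w) = w" by blast
next
  fix w w'
  assume "shd w = 0 \<and> flat (smap vtm_morphism w) = w"
    and "shd w' = 0 \<and> flat (smap vtm_morphism w') = w'"
  then show "w = w'"
    by (intro vtm_approx_snth_eqI) (use fixed_point_vtm_approx in blast)+
qed

lemma vtm_fixed_point: "shd vtm = 0" "flat (smap vtm_morphism vtm) = vtm"
  using theI'[OF vtm_ex1] by (simp_all add: vtm_def)

lemma vtm_approx_vtm: "\<exists>s. vtm = vtm_approx n @- s"
  using fixed_point_vtm_approx vtm_fixed_point by blast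

end

theory Submission
  imports Defs
begin

text \<open>
  Let \<open>t\<close> be the Thue-Morse word. The letter of \<^const>\<open>vtm\<close> at position \<open>j\<close> is
  \<open>1 + t(j) - t(j+1)\<close>, so a Caesar square of half-length \<open>n\<close> and shift \<open>g\<close> that starts at
  position \<open>i\<close> says exactly that \<open>d(j) = t(j+n) - t(j)\<close> satisfies \<open>d(j+1) = d(j) - g\<close> modulo 3
  for \<open>i \<le> j < i+n\<close>. What remains is a question about \<open>t\<close>, governed by the rules
  \<open>t(2k) = t(k)\<close> and \<open>t(2k+1) = 1 - t(k)\<close>. They imply that the two letters of an aligned
  pair, one that starts at an even position, differ; hence equal neighbours start at an odd
  position. Applied one level up, the same fact locates equal letters at distance 2 modulo 4.

  If \<open>g = 0\<close>, then \<open>d\<close> is constant on \<open>i, ..., i+n\<close>. A constant \<open>1\<close> or \<open>-1\<close> would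
  give \<open>t(i+n)\<close> two values, so \<open>d = 0\<close>: an overlap in \<open>t\<close>, excluded by \<open>overlap_free\<close>.

  If \<open>g \<noteq> 0\<close>, then after complementing \<open>t\<close> if necessary \<open>d\<close> runs through \<open>0, 1, 2, 0, 1, 2, ...\<close>,
  so \<open>t\<close> reads \<open>x 0 1 x' 0 1 ...\<close> from \<open>i\<close> on while it reads \<open>x 1 0 x' 1 0 ...\<close> from
  \<open>i+n\<close> on, up to the phase of the cycle. For even \<open>n\<close> a zero of \<open>d\<close> lies at the same place in
  aligned pairs on both sides, which forces \<open>x\<close> to be both \<open>0\<close> and \<open>1\<close>. For odd \<open>n\<close> exactly
  one side is aligned, which makes \<open>x = 1\<close> at even zeros and \<open>x = 0\<close> at odd ones. The equal letters at distance 2 around a zero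
  in the interior then give \<open>n \<equiv> 3\<close> modulo 4 if the zero is even and \<open>n \<equiv> 1\<close> if it is odd
  (\<open>interior_zero\<close>). As zeros have distance 3, both parities occur when \<open>n \<ge> 9\<close>, a
  contradiction. For \<open>n = 7\<close> the letters are so constrained that, read in blocks of four, they
  exhibit letters \<open>0 0 x 0 0\<close> in \<open>t\<close>, with two equal pairs that start at positions of different
  parity.
\<close>

section \<open>The Thue-Morse word up to complement\<close>

text \<open>
  The value at 0 is left open, so that both the Thue-Morse word and its complement qualify and
  the two nonzero Caesar shifts can be treated as one.
\<close>

definition thue_morse_like :: "(nat \<Rightarrow> bool) \<Rightarrow> bool" where
  "thue_morse_like b \<longleftrightarrow> (\<forall>k. b (2 * k) = b k \<and> b (2 * k + 1) = (\<not> b k))"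

lemma thue_morse_like_complement:
  "thue_morse_like b \<Longrightarrow> thue_morse_like (\<lambda>j. \<not> b j)"
  by (simp add: thue_morse_like_def)

context
  fixes b :: "nat \<Rightarrow> bool"
  assumes b: "thue_morse_like b"
begin

lemma
  shows tm_even: "b (2 * k) = b k"
    and tm_odd: "b (Suc (2 * k)) = (\<not> b k)"
  using b by (simp_all add: thue_morse_like_def)

lemma aligned_pair: "even j \<Longrightarrow> b (Suc j) = (\<not> b j)"
  by (auto elim!: evenE simp: tm_even tm_odd)

lemma equal_pair_odd: "b j = b (Suc j) \<Longrightarrow> odd j"
  using aligned_pair by blast

text \<open>
  The letters at even positions spell the word itself, so equal ones at distance 2 come from
  equal neighbours, which start at an odd position.
\<close>

lemma equal_even_letters:
  assumes "even j" "b j = b (j + 2)"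
  shows "j mod 4 = 2"
proof -
  obtain k where k: "j = 2 * k" using assms(1) by blast
  have "b k = b (Suc k)"
    using assms(2) tm_even[of k] tm_even[of "Suc k"] by (simp add: k)
  then have "odd k" by (rule equal_pair_odd)
  then show ?thesis unfolding k by presburger
qed

lemma equal_odd_letters:
  assumes "odd j" "b j = b (j + 2)"
  shows "j mod 4 = 3"
proof -
  obtain k where k: "j = Suc (2 * k)" using assms(1) by (auto elim: oddE)
  have "b k = b (Suc k)"
    using assms(2) tm_odd[of k] tm_odd[of "Suc k"] by (simp add: k)
  then have "odd k" by (rule equal_pair_odd)
  then show ?thesis unfolding k by presburger
qed

lemma no_three_equal: "\<not> (b i = b (Suc i) \<and> b (Suc i) = b (Suc (Suc i)))"
  using equal_pair_odd[of i] equal_pair_odd[of "Suc i"] by auto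

text \<open>
  Alternation over five letters would put equal letters of the same parity both at distance 2 and
  again two places later, against the residue modulo 4 that such a repetition determines.
\<close>

lemma no_five_alternating:
  assumes "\<And>j. i \<le> j \<Longrightarrow> j < i + 4 \<Longrightarrow> b (Suc j) = (\<not> b j)"
  shows False
proof -
  have eq: "b j = b (j + 2)" if "i \<le> j" "j < i + 3" for j
    using assms[of j] assms[of "Suc j"] that by simp
  show False
  proof (cases "even i")
    case True
    then have "i mod 4 = 2" "(i + 2) mod 4 = 2"
      using equal_even_letters[of i] equal_even_letters[of "i + 2"] eq[of i] eq[of "i + 2"] by auto
    then show False by presburger
  next
    case False
    then have "i mod 4 = 3" "(i + 2) mod 4 = 3"
      using equal_odd_letters[of i] equal_odd_letters[of "i + 2"] eq[of i] eq[of "i + 2"] by auto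
    then show False by presburger
  qed
qed

text \<open>
  An even period descends to half of it by keeping the positions with the parity of \<open>i\<close>. For an
  odd period one of \<open>j\<close> and \<open>j + n\<close> starts an aligned pair, so that neighbours differ
  everywhere in the overlap, which is too long for that. Period 1 would be
  three equal letters in a row.
\<close>

lemma overlap_free:
  assumes "n > 0" "\<And>j. i \<le> j \<Longrightarrow> j \<le> i + n \<Longrightarrow> b j = b (j + n)"
  shows False
  using assms
proof (induction n arbitrary: i rule: less_induct)
  case (less n)
  note per = less.prems(2)
  show False
  proof (cases "even n")
    case True
    then obtain m where m: "n = 2 * m" by blast
    have "b k = b (k + m)" if "i div 2 \<le> k" "k \<le> i div 2 + m" for k
    proof (cases "even i")
      case True
      then have "i \<le> 2 * k" "2 * k \<le> i + n" using that m by presburger+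
      then show ?thesis using per[of "2 * k"] tm_even[of k] tm_even[of "k + m"] by (simp add: m)
    next
      case False
      then have "i \<le> Suc (2 * k)" "Suc (2 * k) \<le> i + n" using that m by presburger+
      then show ?thesis
        using per[of "Suc (2 * k)"] tm_odd[of k] tm_odd[of "k + m"] by (simp add: m)
    qed
    then show False using less.IH[of m "i div 2"] less.prems(1) m by simp
  next
    case odd_n: False
    have alt: "b (Suc j) = (\<not> b j) \<and> b (Suc j + n) = (\<not> b (j + n))" if "i \<le> j" "j < i + n" for j
    proof (cases "even j")
      case True
      then show ?thesis using aligned_pair[of j] per[of j] per[of "Suc j"] that by simp
    next
      case False
      then show ?thesis
        using aligned_pair[of "j + n"] per[of j] per[of "Suc j"] that odd_n by simp
    qed
    show False
    proof (cases "n = 1")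
      case True
      then show False using no_three_equal[of i] per[of i] per[of "Suc i"] by simp
    next
      case False
      then have "n \<ge> 3" using odd_n less.prems(1) by presburger
      have "b (Suc j) = (\<not> b j)" if "i \<le> j" "j < i + 4" for j
      proof (cases "j < i + n")
        case True
        then show ?thesis using alt that by blast
      next
        case False
        then show ?thesis using alt[of "j - n"] that \<open>n \<ge> 3\<close> by simp
      qed
      then show False by (rule no_five_alternating)
    qed
  qed
qed

end

section \<open>Differences that increase by one modulo three\<close>

definition shift_diff :: "(nat \<Rightarrow> bool) \<Rightarrow> nat \<Rightarrow> nat \<Rightarrow> 3" where
  "shift_diff b n j = of_bool (b (j + n)) - of_bool (b j)"

lemma shift_diff_eq:
  "shift_diff b n j = 0 \<longleftrightarrow> b (j + n) = b j"
  "shift_diff b n j = 1 \<longleftrightarrow> b (j + n) \<and> \<not> b j"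
  "shift_diff b n j = 2 \<longleftrightarrow> \<not> b (j + n) \<and> b j"
  by (auto simp: shift_diff_def)

text \<open>
  The step hypothesis below is what a Caesar square with nonzero shift says of the Thue-Morse word
  or of its complement. It makes the difference run through the residues cyclically, so that
  the letters around each of its zeros are known on both sides.
\<close>

context
  fixes b :: "nat \<Rightarrow> bool" and i n :: nat
  assumes b: "thue_morse_like b"
    and step: "\<And>j. i \<le> j \<Longrightarrow> j < i + n \<Longrightarrow> shift_diff b n (Suc j) = shift_diff b n j + 1"
begin

lemma zero_next:
  assumes "shift_diff b n j = 0" "i \<le> j" "j < i + n"
  shows "\<not> b (Suc j)" "b (Suc j + n)"
proof -
  have "shift_diff b n (Suc j) = 1" using step[of j] assms by simp
  then show "\<not> b (Suc j)" "b (Suc j + n)" by (simp_all add: shift_diff_eq(2))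
qed

lemma zero_prev:
  assumes "shift_diff b n (Suc j) = 0" "i \<le> j" "j < i + n"
  shows "b j" "\<not> b (j + n)"
proof -
  have "shift_diff b n j + 1 = 0" using step[of j] assms by simp
  then have "shift_diff b n j = 2" by (cases "shift_diff b n j" rule: three_cases) simp_all
  then show "b j" "\<not> b (j + n)" by (simp_all add: shift_diff_eq(3))
qed

lemma zero_next2:
  assumes "shift_diff b n j = 0" "i \<le> j" "j + 2 \<le> i + n"
  shows "b (j + 2)" "\<not> b (j + 2 + n)"
proof -
  have "shift_diff b n (j + 2) = 2" using step[of j] step[of "Suc j"] assms by simp
  then show "b (j + 2)" "\<not> b (j + 2 + n)" by (simp_all add: shift_diff_eq(3))
qed

lemma zero_prev2:
  assumes "shift_diff b n (j + 2) = 0" "i \<le> j" "j + 2 \<le> i + n"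
  shows "\<not> b j" "b (j + n)"
proof -
  have "shift_diff b n j + 1 + 1 = 0" using step[of j] step[of "Suc j"] assms by simp
  then have "shift_diff b n j = 1" by (cases "shift_diff b n j" rule: three_cases) simp_all
  then show "\<not> b j" "b (j + n)" by (simp_all add: shift_diff_eq(2))
qed

lemma shift_diff_add3:
  assumes "i \<le> j" "j + 3 \<le> i + n"
  shows "shift_diff b n (j + 3) = shift_diff b n j"
proof -
  have "shift_diff b n (Suc (Suc (Suc j))) = shift_diff b n j"
    using step[of j] step[of "Suc j"] step[of "Suc (Suc j)"] assms by simp
  then show ?thesis by (simp add: numeral_3_eq_3)
qed

lemma zero_exists:
  assumes "i \<le> a" "a + 2 \<le> i + n"
  obtains p where "a \<le> p" "p \<le> a + 2" "shift_diff b n p = 0"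
proof (cases "shift_diff b n a" rule: three_cases)
  case 1
  then show thesis using that[of a] by simp
next
  case 2
  then show thesis using that[of "a + 2"] step[of a] step[of "Suc a"] assms by simp
next
  case 3
  then show thesis using that[of "Suc a"] step[of a] assms by simp
qed

text \<open>
  Around a zero the neighbours on the two sides are opposite to each other. If the shift preserves
  alignment, both of them differ from the common letter at the zero, which is impossible for bits.
\<close>

lemma even_shift_impossible:
  assumes "even n" "n \<ge> 4"
  shows False
proof -
  \<comment> \<open>The zero must not be at the boundary: its aligned partner may lie on either side.\<close>
  obtain p where p: "i + 1 \<le> p" "p \<le> i + 1 + 2" "shift_diff b n p = 0"
    by (rule zero_exists[of "i + 1"]) (use assms in auto)
  have same: "b (p + n) = b p" using p(3) by (simp add: shift_diff_eq(1))
  show False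
  proof (cases "even p")
    case True
    then show False
      using zero_next[of p] aligned_pair[OF b, of p] aligned_pair[OF b, of "p + n"] p assms same by simp
  next
    case False
    then obtain q where q: "p = Suc q" "even q" by (cases p) auto
    then show False
      using zero_prev[of q] aligned_pair[OF b, of q] aligned_pair[OF b, of "q + n"] p assms same by simp
  qed
qed

text \<open>
  Exactly one of \<open>p\<close> and \<open>p + n\<close> starts an aligned pair. On either side the partner's letter is
  known, and it determines the common letter at the zero. At the right end of the range the pairs
  that end at \<open>p\<close> and \<open>p + n\<close> take this part.
\<close>

lemma zero_letter:
  assumes "odd n" "i \<le> p" "p \<le> i + n" "shift_diff b n p = 0"
  shows "b p \<longleftrightarrow> even p" "b (p + n) \<longleftrightarrow> even p"
proof -
  have same: "b (p + n) = b p" using assms by (simp add: shift_diff_eq(1))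
  show "b p \<longleftrightarrow> even p"
  proof (cases "p < i + n")
    case True
    then show ?thesis
      using zero_next[of p] aligned_pair[OF b, of p] aligned_pair[OF b, of "p + n"] assms same
      by auto
  next
    case False
    have "n > 0" using assms(1) by (rule odd_pos)
    with False obtain q where q: "p = Suc q" "i \<le> q" "q < i + n" using assms by (cases p) auto
    then show ?thesis
      using zero_prev[of q] aligned_pair[OF b, of q] aligned_pair[OF b, of "q + n"] assms same
      by auto
  qed
  then show "b (p + n) \<longleftrightarrow> even p" using same by simp
qed

text \<open>
  At an even zero the letters at \<open>p\<close> and \<open>p + 2\<close> agree, and so do those at \<open>p - 2 + n\<close> and
  \<open>p + n\<close>; at an odd zero the two sides exchange roles. Each equality fixes a residue modulo 4.
\<close>

lemma interior_zero:
  assumes "odd n" "i + 2 \<le> p" "p + 2 \<le> i + n" "shift_diff b n p = 0"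
  shows "even p \<Longrightarrow> p mod 4 = 2 \<and> n mod 4 = 3"
    and "odd p \<Longrightarrow> n mod 4 = 1"
proof -
  obtain q where q: "p = q + 2" using assms(2) by (metis add.commute le_add2 le_trans nat_le_iff_add)
  note letters = zero_letter[of p] zero_next2[of p] zero_prev2[of q]
  show "p mod 4 = 2 \<and> n mod 4 = 3" if "even p"
  proof -
    have p2: "p mod 4 = 2"
      using equal_even_letters[OF b, of p] letters assms that by simp
    moreover have "(q + n) mod 4 = 3"
      using equal_odd_letters[OF b, of "q + n"] letters assms that q
      by (simp add: ac_simps)
    moreover have "(q + n) mod 4 = (q mod 4 + n mod 4) mod 4" by (simp add: mod_simps)
    moreover have "q mod 4 = 0" using p2 unfolding q by presburger
    ultimately show ?thesis using p2 by simp
  qed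
  show "n mod 4 = 1" if "odd p"
  proof -
    have "(p + n) mod 4 = 2"
      using equal_even_letters[OF b, of "p + n"] letters assms that by (simp add: ac_simps)
    moreover have q3: "q mod 4 = 3"
      using equal_odd_letters[OF b, of q] letters assms that q by simp
    moreover have "(p + n) mod 4 = (p mod 4 + n mod 4) mod 4" by (simp add: mod_simps)
    moreover have "p mod 4 = 1" using q3 unfolding q by presburger
    moreover have "n mod 4 < 4" by simp
    ultimately show ?thesis by presburger
  qed
qed

lemma large_odd_shift_impossible:
  assumes "odd n" "n \<ge> 9"
  shows False
proof -
  obtain p where p: "i + 2 \<le> p" "p \<le> i + 2 + 2" "shift_diff b n p = 0"
    by (rule zero_exists[of "i + 2"]) (use assms in auto)
  have p3: "shift_diff b n (p + 3) = 0" using shift_diff_add3[of p] p assms by simp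
  have bounds: "i + 2 \<le> p + 3" "p + 2 \<le> i + n" "p + 3 + 2 \<le> i + n" using p assms by simp_all
  show False
  proof (cases "even p")
    case True
    then have "n mod 4 = 3" "n mod 4 = 1"
      using interior_zero(1)[of p] interior_zero(2)[of "p + 3"] p p3 bounds assms(1) by simp_all
    then show False by simp
  next
    case False
    then have "n mod 4 = 1" "n mod 4 = 3"
      using interior_zero(2)[of p] interior_zero(1)[of "p + 3"] p p3 bounds assms(1) by simp_all
    then show False by simp
  qed
qed

text \<open>
  An interior zero \<open>p\<close> must now be even, since 7 is 3 modulo 4, and so \<open>p = 4 (m + 1) + 2\<close>. One
  letter of an aligned block of length 4 determines the letter from which the block arises. The
  letters known around \<open>p\<close> and \<open>p + 7\<close> thus make those at \<open>m\<close>, \<open>m + 1\<close>, \<open>m + 3\<close> and \<open>m + 4\<close>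
  equal to 0, so that equal pairs start at both \<open>m\<close> and \<open>m + 3\<close>.
\<close>

lemma shift_seven_impossible:
  assumes n: "n = 7"
  shows False
proof -
  obtain p where p: "i + 3 \<le> p" "p \<le> i + 3 + 2" "shift_diff b n p = 0"
    by (rule zero_exists[of "i + 3"]) (use n in auto)
  have mod4: "p mod 4 = 2" using interior_zero[of p] p n by (cases "even p") auto
  \<comment> \<open>Otherwise the zero at \<open>p - 3\<close> would be interior as well, and odd.\<close>
  have p4: "p \<le> i + 4"
  proof (rule ccontr)
    assume "\<not> p \<le> i + 4"
    then have pi: "p = i + 5" using p by simp
    have "shift_diff b n (i + 2) = 0"
      using shift_diff_add3[of "i + 2"] p(3) n by (simp add: pi ac_simps)
    then show False using interior_zero[of "i + 2"] n mod4 pi by simp presburger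
  qed
  \<comment> \<open>As \<open>p \<ge> 3\<close>, the residue excludes \<open>p = 2\<close>, so there is a block before that of \<open>p\<close>.\<close>
  obtain m where m: "p = 4 * Suc m + 2"
  proof -
    have "p = 4 * Suc (p div 4 - 1) + 2" using p mod4 by presburger
    then show thesis by (rule that)
  qed
  have q: "i \<le> 4 * m + 3" "4 * m + 3 + 3 \<le> i + n" using p p4 n m by simp_all
  have "shift_diff b n (4 * m + 3) = 0"
    using shift_diff_add3[of "4 * m + 3"] q p(3) by (simp add: m)
  then have "\<not> b (4 * m + 3)" using zero_letter(1)[of "4 * m + 3"] q n by simp
  moreover have "b p" using zero_letter(1)[of p] p n mod4 by (simp add: m)
  moreover have "\<not> b (p + 6)"
    using zero_prev(2)[of "p - 1"] p p4 n by (simp add: m eval_nat_numeral)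
  moreover have "\<not> b (p + 10)"
    using zero_letter(2)[of "p + 3"] shift_diff_add3[of p] p p4 n by (simp add: m)
  moreover have "p = 4 * (m + 1) + 2" "p + 6 = 4 * (m + 3)"
    "p + 10 = 4 * (m + 4)"
    using m by simp_all
  moreover have "b (4 * k) = b k" "b (4 * k + 2) = (\<not> b k)" "b (4 * k + 3) = b k" for k
    using tm_even[OF b, of "2 * k"] tm_even[OF b, of k] tm_odd[OF b, of k]
      tm_even[OF b, of "Suc (2 * k)"] tm_odd[OF b, of "Suc (2 * k)"]
    by (simp_all add: numeral_3_eq_3)
  ultimately have "\<not> b m" "\<not> b (m + 1)" "\<not> b (m + 3)" "\<not> b (m + 4)" by metis+
  then have "b m = b (Suc m)" "b (m + 3) = b (Suc (m + 3))" by (simp_all add: eval_nat_numeral)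
  then have "odd m" "odd (m + 3)" using equal_pair_odd[OF b] by blast+
  then show False by simp
qed

end

section \<open>The word vtm as differences of Thue-Morse letters\<close>

fun thue_morse :: "nat \<Rightarrow> bool" where
  "thue_morse n = (if n = 0 then False else thue_morse (n div 2) \<noteq> odd n)"

declare thue_morse.simps [simp del]

lemma thue_morse_like: "thue_morse_like thue_morse"
  unfolding thue_morse_like_def
proof (intro allI conjI)
  fix k
  show "thue_morse (2 * k) = thue_morse k"
    by (cases "k = 0") (simp_all add: thue_morse.simps[of "2 * k"])
  show "thue_morse (2 * k + 1) = (\<not> thue_morse k)"
    by (simp add: thue_morse.simps[of "Suc (2 * k)"])
qed

definition vtm_letter :: "nat \<Rightarrow> 3" where
  "vtm_letter n = 1 + of_bool (thue_morse n) - of_bool (thue_morse (Suc n))"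

text \<open>
  The Thue-Morse substitution doubles lengths whereas the morphism of \<^const>\<open>vtm\<close> has images of
  lengths 3, 2 and 1. On the first \<open>n\<close> letters the two nevertheless produce the same word up to
  one trailing letter 2, which is present exactly when the Thue-Morse letter reached is 1: it is carried over from one letter to the next.
\<close>

lemma morphism_vtm_letter:
  "concat (map vtm_morphism (map vtm_letter [0..<n]))
    = map vtm_letter [0..<2 * n] @ (if thue_morse n then [2] else [])"
proof (induction n)
  case 0
  show ?case by (simp add: thue_morse.simps)
next
  case (Suc n)
  have "(if thue_morse n then [2] else []) @ vtm_morphism (vtm_letter n)
    = [vtm_letter (2 * n), vtm_letter (Suc (2 * n))] @ (if thue_morse (Suc n) then [2] else [])"
    using tm_even[OF thue_morse_like, of n] tm_odd[OF thue_morse_like, of n]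
      tm_even[OF thue_morse_like, of "Suc n"]
    by (simp add: vtm_letter_def vtm_morphism_def)
  with Suc show ?case by simp
qed

lemma vtm_approx_letters: "\<exists>m. vtm_approx n = map vtm_letter [0..<m]"
proof (induction n)
  case 0
  have "vtm_letter 0 = 0" by (simp add: vtm_letter_def thue_morse.simps)
  then have "vtm_approx 0 = map vtm_letter [0..<1]" by (simp add: vtm_approx_0)
  then show ?case by blast
next
  case (Suc n)
  then obtain m where m: "vtm_approx n = map vtm_letter [0..<m]" by blast
  have next_letter: "vtm_letter (2 * m) = 2" if "thue_morse m"
    using that tm_even[OF thue_morse_like, of m] tm_odd[OF thue_morse_like, of m]
    by (simp add: vtm_letter_def)
  have "vtm_approx (Suc n) = map vtm_letter [0..<2 * m] @ (if thue_morse m then [2] else [])"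
    unfolding vtm_approx_Suc m by (rule morphism_vtm_letter)
  also have "\<dots> = map vtm_letter [0..<2 * m + of_bool (thue_morse m)]"
    using next_letter by simp
  finally show ?case by blast
qed

lemma vtm_nth: "vtm !! n = vtm_letter n"
proof -
  obtain s where s: "vtm = vtm_approx n @- s" using vtm_approx_vtm by blast
  obtain m where m: "vtm_approx n = map vtm_letter [0..<m]" using vtm_approx_letters by blast
  have "n < m" using vtm_approx_length[of n] m by simp
  then show ?thesis by (simp add: s m)
qed

section \<open>Caesar squares in vtm\<close>

lemma caesar_square_in_vtm:
  assumes "factor u vtm" "caesar_square u"
  obtains i n g where "length u = 2 * n"
    "\<And>j. i \<le> j \<Longrightarrow> j < i + n \<Longrightarrow> vtm_letter (j + n) = vtm_letter j + g"
proof -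
  obtain pre s where vtm: "vtm = pre @- u @- s" using assms(1) by (auto simp: factor_def)
  obtain x g where u: "u = x @ caesar_shift g x"
    using assms(2) by (auto simp: caesar_square_def)
  have len: "length u = 2 * length x" by (simp add: u caesar_shift_def)
  have letter: "vtm_letter (length pre + k) = u ! k" if "k < length u" for k
    using that by (simp flip: vtm_nth add: vtm)
  show thesis
  proof (rule that[OF len])
    fix j
    assume "length pre \<le> j" "j < length pre + length x"
    then obtain k where k: "j = length pre + k" "k < length x"
      by (metis add_less_cancel_left le_iff_add)
    then show "vtm_letter (j + length x) = vtm_letter j + g"
      using letter[of k] letter[of "k + length x"] len
      by (simp add: u nth_append caesar_shift_def add.assoc)
  qed
qed

text \<open>
  The letters are themselves differences of neighbours, so a difference of letters at distance
  \<open>n\<close> can be regrouped as a difference of neighbouring differences at distance \<open>n\<close>.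
\<close>

lemma caesar_relation_shift_diff:
  assumes "vtm_letter (j + n) = vtm_letter j + g"
  shows "shift_diff thue_morse n (Suc j) = shift_diff thue_morse n j - g"
  using assms by (simp add: vtm_letter_def shift_diff_def algebra_simps)

lemma rising_shift_diff_impossible:
  assumes "thue_morse_like b" "n \<ge> 6"
    and "\<And>j. i \<le> j \<Longrightarrow> j < i + n \<Longrightarrow> shift_diff b n (Suc j) = shift_diff b n j + 1"
  shows False
proof (cases "even n")
  case True
  then show False using even_shift_impossible[of b i n] assms by simp
next
  case False
  then have "n = 7 \<or> n \<ge> 9" using assms(2) by presburger
  then show False
    using shift_seven_impossible[of b i n] large_odd_shift_impossible[of b i n] assms False by blast
qed

lemma constant_shift_diff_impossible:
  assumes "thue_morse_like b" "n > 0"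
    and "\<And>j. i \<le> j \<Longrightarrow> j < i + n \<Longrightarrow> shift_diff b n (Suc j) = shift_diff b n j"
  shows False
proof -
  have const: "shift_diff b n j = shift_diff b n i" if "i \<le> j" "j \<le> i + n" for j
    using that(1,2) by (induction j rule: dec_induct) (simp_all add: assms(3))
  \<comment> \<open>The letter at \<open>i + n\<close> is the second one in the difference at \<open>i\<close> and the first one in
    the difference at \<open>i + n\<close>, so equal differences must vanish.\<close>
  have "shift_diff b n (i + n) = shift_diff b n i" by (rule const) simp_all
  then have "shift_diff b n i = 0"
    by (cases "shift_diff b n i" rule: three_cases) (simp_all add: shift_diff_eq)
  then have "b j = b (j + n)" if "i \<le> j" "j \<le> i + n" for j
    using const[OF that] \<open>shift_diff b n i = 0\<close> by (simp only: shift_diff_eq)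
  then show False using overlap_free[OF assms(1,2)] by blast
qed

theorem theorem4p1:
  shows "\<forall>u. factor u vtm \<and> length u \<ge> 12 \<longrightarrow> \<not> caesar_square u"
proof (intro allI impI notI, elim conjE)
  fix u
  assume "factor u vtm" "length u \<ge> 12" "caesar_square u"
  then obtain i n g where n: "length u = 2 * n" and
    "\<And>j. i \<le> j \<Longrightarrow> j < i + n \<Longrightarrow> vtm_letter (j + n) = vtm_letter j + g"
    by (metis caesar_square_in_vtm)
  then have step: "shift_diff thue_morse n (Suc j) = shift_diff thue_morse n j - g"
    if "i \<le> j" "j < i + n" for j
    using that caesar_relation_shift_diff by blast
  have "n \<ge> 6" using n \<open>length u \<ge> 12\<close> by simp
  show False
  proof (cases g rule: three_cases)
    case 1
    then show False
      using constant_shift_diff_impossible[OF thue_morse_like, of n i] step \<open>n \<ge> 6\<close> by simp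
  next
    case 2
    have "shift_diff (\<lambda>j. \<not> thue_morse j) n j = - shift_diff thue_morse n j" for j
      by (simp add: shift_diff_def)
    then show False
      using rising_shift_diff_impossible[OF thue_morse_like_complement[OF thue_morse_like] \<open>n \<ge> 6\<close>, of i]
        step 2 by simp
  next
    case 3
    have "shift_diff thue_morse n j - 2 = shift_diff thue_morse n j + 1" for j
      by (cases "shift_diff thue_morse n j" rule: three_cases) simp_all
    then show False
      using rising_shift_diff_impossible[OF thue_morse_like \<open>n \<ge> 6\<close>, of i] step 3 by simp
  qed
qed

end
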